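(* Let $\mathfrak{g}=V+\mathfrak{sl}(V)+V^*$, $V=\mathbb{R}^3$, be the split real form of the simple Lie algebra of type $G_2$ and $\mathfrak{l}=\mathfrak{a}+\mathrm{span}\{e_1,e^2,e^3,e_1^2,e_1^3,e_2^3\}\subset\mathfrak{g}$, where $\mathfrak{a}$ is the space of trace-free diagonal matrices in $\mathfrak{sl}(V)$. Then the Lie algebra $\mathfrak{l}$ admits a basis $(G_0,H_0,G_1,H_1,\tilde P_-,\tilde P_+,\tilde Q_-,\tilde Q_+)$ with the following nontrivial brackets (all brackets of basis elements not determined by these and skew-symmetry being zero): $$[H_0,G_0]=G_0,\qquad [H_1,G_1]=\tfrac1{\sqrt3}G_1,$$ $$[H_0,\tilde U]=\tfrac12\tilde U\quad\text{for all }\tilde U\in\mathrm{span}\{\tilde P_-,\tilde P_+,\tilde Q_-,\tilde Q_+\},$$ $$[H_1,\tilde P_-]=\tfrac{\sqrt3}{2}\tilde P_-,\quad [H_1,\tilde P_+]=\tfrac1{2\sqrt3}\tilde P_+,\quad [H_1,\tilde Q_-]=-\tfrac{\sqrt3}{2}\tilde Q_-,\quad [H_1,\tilde Q_+]=-\tfrac1{2\sqrt3}\tilde Q_+,$$ $$[G_1,\tilde P_+]=-\tilde P_-,\quad [G_1,\tilde Q_-]=\tilde Q_+,\quad [G_1,\tilde Q_+]=\tfrac{2}{\sqrt3}\tilde P_+,$$ $$[\tilde Q_-,\tilde P_-]=[\tilde Q_+,\tilde P_+]=G_0.$$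
   Context: Lie algebra $\mathfrak{g}$: $V=\mathbb{R}^3$ with standard basis $(e_1,e_2,e_3)$, dual basis $(e^1,e^2,e^3)$ of $V^*$, and $e_i^j=e_i\otimes e^j\in\mathfrak{gl}(V)$. As a vector space $\mathfrak{g}=V\oplus\mathfrak{sl}(V)\oplus V^*$; $\mathfrak{sl}(V)$ is a subalgebra acting on $V$ and $V^*$ by the standard and the dual representation, and the remaining brackets are, for $x,y\in V$, $\xi,\eta\in V^*$, $[x,y]=-2\,x\times y$, $[\xi,\eta]=2\,\xi\times\eta$, $[x,\xi]=3x\otimes\xi-\xi(x)\mathrm{Id}\in\mathfrak{sl}(V)$, where $x\times y=\det(x,y,\cdot)\in V^*$ and $\xi\times\eta=\det^{-1}(\xi,\eta,\cdot)\in V^{**}=V$ (so $e_1\times e_2=e^3$, $e^1\times e^2=e_3$, and cyclically). $\mathfrak{a}=\{\sum_i\lambda_ie_i^i\mid\sum_i\lambda_i=0\}$. *)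

theory Defs
  imports "HOL-Analysis.Analysis"
begin

section \<open>Lie algebras as subsets of a real vector space\<close>

definition lie_algebra_on :: "'a::real_vector set \<Rightarrow> ('a \<Rightarrow> 'a \<Rightarrow> 'a) \<Rightarrow> bool" where
  "lie_algebra_on S br \<longleftrightarrow>
     subspace S \<and>
     (\<forall>x\<in>S. \<forall>y\<in>S. br x y \<in> S) \<and>
     (\<forall>x\<in>S. \<forall>y\<in>S. \<forall>z\<in>S. \<forall>c d. br (c *\<^sub>R x + d *\<^sub>R y) z = c *\<^sub>R br x z + d *\<^sub>R br y z) \<and>
     (\<forall>x\<in>S. \<forall>y\<in>S. \<forall>z\<in>S. \<forall>c d. br z (c *\<^sub>R x + d *\<^sub>R y) = c *\<^sub>R br z x + d *\<^sub>R br z y) \<and>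
     (\<forall>x\<in>S. br x x = 0) \<and>
     (\<forall>x\<in>S. \<forall>y\<in>S. \<forall>z\<in>S. br x (br y z) + br y (br z x) + br z (br x y) = 0)"

definition is_basis_list :: "'a::real_vector set \<Rightarrow> 'a list \<Rightarrow> bool" where
  "is_basis_list S bs \<longleftrightarrow> distinct bs \<and> independent (set bs) \<and> span (set bs) = S"


section \<open>The algebra \<open>V \<oplus> sl(V) \<oplus> V*\<close> for \<open>V = \<real>\<^sup>3\<close>\<close>

text \<open>
  A covector is given by its coordinates in the dual basis, so that \<open>V*\<close> is again \<open>real ^ 3\<close>
  and the value of \<open>\<xi>\<close> at \<open>x\<close> is \<open>\<xi> \<bullet> x\<close>. A triple \<open>(x, A, \<xi>)\<close> stands for the element with
  component \<open>x\<close> in \<open>V\<close>, \<open>A\<close> in \<open>gl(V)\<close> and \<open>\<xi>\<close> in \<open>V*\<close>.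
\<close>

type_synonym vec_end_covec = "(real ^ 3) \<times> (real ^ 3 ^ 3) \<times> (real ^ 3)"

definition tensor :: "real ^ 3 \<Rightarrow> real ^ 3 \<Rightarrow> real ^ 3 ^ 3" where
  "tensor x \<xi> = (\<chi> i j. x $ i * \<xi> $ j)"

lemma tensor_apply: "tensor x \<xi> *v y = (\<xi> \<bullet> y) *\<^sub>R x"
  by (simp add: tensor_def vec_eq_iff matrix_vector_mult_def inner_vec_def sum_3 algebra_simps)

definition dual_action :: "real ^ 3 ^ 3 \<Rightarrow> real ^ 3 \<Rightarrow> real ^ 3" where
  "dual_action A \<xi> = - (transpose A *v \<xi>)"

lemma dual_action_apply: "dual_action A \<xi> \<bullet> x = - (\<xi> \<bullet> (A *v x))"
  by (simp add: dual_action_def dot_lmul_matrix)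

text \<open>
  Both products \<open>V \<times> V \<rightarrow> V*\<close> and \<open>V* \<times> V* \<rightarrow> V\<close> have the coordinates of \<^const>\<open>cross3\<close>: in
  dual coordinates the inverse determinant is again the determinant of the coordinate vectors.
\<close>

lemma cross3_eq_det: "cross3 x y \<bullet> z = det (vector [x, y, z])"
  by (simp add: cross3_def inner_vec_def sum_3 det_3 algebra_simps)

definition in_V :: "real ^ 3 \<Rightarrow> vec_end_covec" where
  "in_V x = (x, 0, 0)"

definition in_gl :: "real ^ 3 ^ 3 \<Rightarrow> vec_end_covec" where
  "in_gl A = (0, A, 0)"

definition in_Vdual :: "real ^ 3 \<Rightarrow> vec_end_covec" where
  "in_Vdual \<xi> = (0, 0, \<xi>)"

definition g2_split :: "vec_end_covec set" where
  "g2_split = {(x, A, \<xi>). trace A = 0}"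

fun g2_bracket :: "vec_end_covec \<Rightarrow> vec_end_covec \<Rightarrow> vec_end_covec" where
  "g2_bracket (x, A, \<xi>) (y, B, \<eta>) =
     ( A *v y - B *v x + 2 *\<^sub>R cross3 \<xi> \<eta>,
       (A ** B - B ** A)
         + (3 *\<^sub>R tensor x \<eta> - (\<eta> \<bullet> x) *\<^sub>R mat 1)
         - (3 *\<^sub>R tensor y \<xi> - (\<xi> \<bullet> y) *\<^sub>R mat 1),
       dual_action A \<eta> - dual_action B \<xi> - 2 *\<^sub>R cross3 x y )"

lemma tensor_zero: "tensor 0 \<xi> = 0" "tensor x 0 = 0"
  by (simp_all add: tensor_def vec_eq_iff)

lemma g2_bracket_components:
  "g2_bracket (in_gl A) (in_gl B) = in_gl (A ** B - B ** A)"
  "g2_bracket (in_gl A) (in_V y) = in_V (A *v y)"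
  "g2_bracket (in_gl A) (in_Vdual \<eta>) = in_Vdual (dual_action A \<eta>)"
  "g2_bracket (in_V x) (in_V y) = in_Vdual (-2 *\<^sub>R cross3 x y)"
  "g2_bracket (in_Vdual \<xi>) (in_Vdual \<eta>) = in_V (2 *\<^sub>R cross3 \<xi> \<eta>)"
  "g2_bracket (in_V x) (in_Vdual \<eta>) = in_gl (3 *\<^sub>R tensor x \<eta> - (\<eta> \<bullet> x) *\<^sub>R mat 1)"
  by (simp_all add: in_V_def in_gl_def in_Vdual_def dual_action_def tensor_zero)

lemma trace_zero: "trace (0 :: real ^ 'n ^ 'n) = 0"
  by (simp add: trace_def)

lemma trace_scaleR: "trace (c *\<^sub>R A) = c * trace (A :: real ^ 'n ^ 'n)"
  by (simp add: trace_def sum_distrib_left)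

lemma mat1_entries:
  "(mat 1 :: real ^ 3 ^ 3) $ 1 $ 1 = 1" "(mat 1 :: real ^ 3 ^ 3) $ 1 $ 2 = 0"
  "(mat 1 :: real ^ 3 ^ 3) $ 1 $ 3 = 0" "(mat 1 :: real ^ 3 ^ 3) $ 2 $ 1 = 0"
  "(mat 1 :: real ^ 3 ^ 3) $ 2 $ 2 = 1" "(mat 1 :: real ^ 3 ^ 3) $ 2 $ 3 = 0"
  "(mat 1 :: real ^ 3 ^ 3) $ 3 $ 1 = 0" "(mat 1 :: real ^ 3 ^ 3) $ 3 $ 2 = 0"
  "(mat 1 :: real ^ 3 ^ 3) $ 3 $ 3 = 1"
  by (simp_all add: mat_def)

lemma g2_split_lie_algebra: "lie_algebra_on g2_split g2_bracket"
proof -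
  note coord = vec_eq_iff forall_3 sum_3 matrix_vector_mult_def matrix_matrix_mult_def
    transpose_def mat_def tensor_def dual_action_def cross3_def inner_vec_def
  have sub: "subspace g2_split"
    by (auto simp: subspace_def g2_split_def zero_prod_def trace_add trace_zero trace_scaleR)
  have closed: "g2_bracket u v \<in> g2_split" if "u \<in> g2_split" "v \<in> g2_split" for u v
    by (cases u; cases v) (simp add: g2_split_def trace_def coord algebra_simps)
  have lin1: "g2_bracket (c *\<^sub>R u + d *\<^sub>R v) w = c *\<^sub>R g2_bracket u w + d *\<^sub>R g2_bracket v w"
    for u v w c d
    by (cases u; cases v; cases w) (simp add: coord algebra_simps)
  have lin2: "g2_bracket w (c *\<^sub>R u + d *\<^sub>R v) = c *\<^sub>R g2_bracket w u + d *\<^sub>R g2_bracket w v"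
    for u v w c d
    by (cases u; cases v; cases w) (simp add: coord algebra_simps)
  have alt: "g2_bracket u u = 0" for u
    by (cases u) (simp add: coord zero_prod_def)
  have jac: "g2_bracket u (g2_bracket v w) + g2_bracket v (g2_bracket w u)
      + g2_bracket w (g2_bracket u v) = 0"
    if mem: "u \<in> g2_split" "v \<in> g2_split" "w \<in> g2_split" for u v w
  proof -
    obtain x A \<xi> y B \<eta> z C \<zeta> where
      uvw: "u = (x, A, \<xi>)" "v = (y, B, \<eta>)" "w = (z, C, \<zeta>)"
      by (cases u; cases v; cases w) auto
    have tr: "A $ 3 $ 3 = - A $ 1 $ 1 - A $ 2 $ 2" "B $ 3 $ 3 = - B $ 1 $ 1 - B $ 2 $ 2"
      "C $ 3 $ 3 = - C $ 1 $ 1 - C $ 2 $ 2"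
      using mem by (simp_all add: g2_split_def uvw trace_def sum_3)
    show ?thesis
      unfolding uvw
      by (simp only: g2_bracket.simps add_Pair zero_prod_def prod.inject vec_eq_iff forall_3
          sum_3 matrix_vector_mult_def matrix_matrix_mult_def transpose_def tensor_def
          dual_action_def cross3_def inner_vec_def mat1_entries
          vector_add_component vector_minus_component vector_uminus_component
          vector_scaleR_component zero_index vec_lambda_beta vector_3 real_scaleR_def
          inner_real_def tr, intro conjI) algebra+
  qed
  show ?thesis
    unfolding lie_algebra_on_def using sub closed lin1 lin2 alt jac by blast
qed


section \<open>The subalgebra \<open>l\<close>\<close>

abbreviation evec :: "3 \<Rightarrow> real ^ 3" where
  "evec i \<equiv> axis i 1"

text \<open>\<open>e_up i j\<close> is \<open>e\<^sub>i \<otimes> e\<^sup>j\<close>, with its single entry 1 in row \<open>i\<close> and column \<open>j\<close>.\<close>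

definition e_up :: "3 \<Rightarrow> 3 \<Rightarrow> real ^ 3 ^ 3" where
  "e_up i j = tensor (evec i) (evec j)"

definition diag_a :: "vec_end_covec set" where
  "diag_a = {in_gl (\<Sum>i\<in>UNIV. \<mu> i *\<^sub>R e_up i i) | \<mu> :: 3 \<Rightarrow> real. (\<Sum>i\<in>UNIV. \<mu> i) = 0}"

definition l_alg :: "vec_end_covec set" where
  "l_alg = {d + n | d n. d \<in> diag_a \<and>
     n \<in> span {in_V (evec 1), in_Vdual (evec 2), in_Vdual (evec 3),
               in_gl (e_up 1 2), in_gl (e_up 1 3), in_gl (e_up 2 3)}}"

lemma l_alg_iff:
  "(x, A, \<xi>) \<in> l_alg \<longleftrightarrow> trace A = 0 \<and> x $ 2 = 0 \<and> x $ 3 = 0 \<and> \<xi> $ 1 = 0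
     \<and> A $ 2 $ 1 = 0 \<and> A $ 3 $ 1 = 0 \<and> A $ 3 $ 2 = 0"
proof -
  have span_iff: "v \<in> span {in_V (evec 1), in_Vdual (evec 2), in_Vdual (evec 3),
               in_gl (e_up 1 2), in_gl (e_up 1 3), in_gl (e_up 2 3)} \<longleftrightarrow>
     (\<exists>a b c p q r. v = a *\<^sub>R in_V (evec 1) + b *\<^sub>R in_Vdual (evec 2) + c *\<^sub>R in_Vdual (evec 3)
        + p *\<^sub>R in_gl (e_up 1 2) + q *\<^sub>R in_gl (e_up 1 3) + r *\<^sub>R in_gl (e_up 2 3))" for v
    by (simp add: span_breakdown_eq algebra_simps)
  note coord = in_V_def in_Vdual_def in_gl_def e_up_def tensor_def vec_eq_iff forall_3 sum_3
    axis_def trace_def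
  show ?thesis
  proof
    assume "(x, A, \<xi>) \<in> l_alg"
    then show "trace A = 0 \<and> x $ 2 = 0 \<and> x $ 3 = 0 \<and> \<xi> $ 1 = 0
       \<and> A $ 2 $ 1 = 0 \<and> A $ 3 $ 1 = 0 \<and> A $ 3 $ 2 = 0"
      unfolding l_alg_def diag_a_def span_iff by (auto simp: coord)
  next
    assume h: "trace A = 0 \<and> x $ 2 = 0 \<and> x $ 3 = 0 \<and> \<xi> $ 1 = 0
       \<and> A $ 2 $ 1 = 0 \<and> A $ 3 $ 1 = 0 \<and> A $ 3 $ 2 = 0"
    have "in_gl (\<Sum>i\<in>UNIV. (A $ i $ i) *\<^sub>R e_up i i) \<in> diag_a"
      using h by (auto simp: diag_a_def trace_def)
    moreover have "(x, A, \<xi>) = in_gl (\<Sum>i\<in>UNIV. (A $ i $ i) *\<^sub>R e_up i i)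
      + (x $ 1 *\<^sub>R in_V (evec 1) + \<xi> $ 2 *\<^sub>R in_Vdual (evec 2) + \<xi> $ 3 *\<^sub>R in_Vdual (evec 3)
        + A $ 1 $ 2 *\<^sub>R in_gl (e_up 1 2) + A $ 1 $ 3 *\<^sub>R in_gl (e_up 1 3)
        + A $ 2 $ 3 *\<^sub>R in_gl (e_up 2 3))"
      using h by (simp add: coord)
    ultimately show "(x, A, \<xi>) \<in> l_alg"
      unfolding l_alg_def span_iff by blast
  qed
qed

lemma l_alg_subset: "l_alg \<subseteq> g2_split"
  by (auto simp: g2_split_def l_alg_iff)

lemma l_alg_lie_algebra: "lie_algebra_on l_alg g2_bracket"
proof -
  note coord = sum_3 matrix_vector_mult_def matrix_matrix_mult_def trace_def
    transpose_def mat_def tensor_def dual_action_def cross3_def inner_vec_def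
  have "subspace l_alg"
    by (auto simp: subspace_def l_alg_iff zero_prod_def trace_add trace_zero trace_scaleR)
  moreover have "g2_bracket u v \<in> l_alg" if "u \<in> l_alg" "v \<in> l_alg" for u v
    using that by (cases u; cases v) (simp add: l_alg_iff coord algebra_simps)
  ultimately show ?thesis
    using g2_split_lie_algebra l_alg_subset unfolding lie_algebra_on_def subset_iff by blast
qed

end

theory Submission
  imports Defs
begin

text \<open>
  With the simple roots \<open>\<alpha>\<close> of \<open>e\<^sup>2\<close> and \<open>\<beta>\<close> of \<open>e\<^sub>2\<^sup>3\<close>, the positive root vectors of \<open>l\<close> are
  \<open>e\<^sup>2, e\<^sub>2\<^sup>3, e\<^sup>3, e\<^sub>1, e\<^sub>1\<^sup>2, e\<^sub>1\<^sup>3\<close>, with roots \<open>\<alpha>, \<beta>, \<alpha> + \<beta>, 2\<alpha> + \<beta>, 3\<alpha> + \<beta>, 3\<alpha> + 2\<beta>\<close>.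
  Comparing weights identifies these, up to scale, with \<open>G\<^sub>1, Q\<^sub>-, Q\<^sub>+, P\<^sub>+, P\<^sub>-, G\<^sub>0\<close>, and fixes
  \<open>H\<^sub>0, H\<^sub>1\<close> as diagonal matrices. Putting \<open>G\<^sub>1 = e\<^sup>2\<close> and \<open>Q\<^sub>- = e\<^sub>2\<^sup>3\<close>, the brackets with \<open>G\<^sub>1\<close>
  determine \<open>Q\<^sub>+, P\<^sub>+, P\<^sub>-\<close> in turn; then \<open>[Q\<^sub>-, P\<^sub>-] = [Q\<^sub>+, P\<^sub>+]\<close> is the value of \<open>G\<^sub>0\<close>.
\<close>

definition trace_free_diag :: "real \<Rightarrow> real \<Rightarrow> real ^ 3 ^ 3" where
  "trace_free_diag a b = (\<chi> i j. if i = j then vector [a, b, - a - b] $ i else 0)"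

text \<open>Each root space in \<open>l_alg\<close> is a line, so any nonzero multiple of its root
  vector will do. Trace zero leaves two free diagonal entries, so the diagonal part reduces to a 2x2
  determinant.\<close>

lemma root_basis_l_alg:
  assumes nonzero: "g0 \<noteq> 0" "g1 \<noteq> 0" "pm \<noteq> 0" "pp \<noteq> 0" "qm \<noteq> 0" "qp \<noteq> 0"
    and det: "a1 * b2 \<noteq> a2 * b1"
  shows "is_basis_list l_alg
    [in_gl (g0 *\<^sub>R e_up 1 3), in_gl (trace_free_diag a1 a2), in_Vdual (g1 *\<^sub>R evec 2),
     in_gl (trace_free_diag b1 b2), in_gl (pm *\<^sub>R e_up 1 2), in_V (pp *\<^sub>R evec 1),
     in_gl (qm *\<^sub>R e_up 2 3), in_Vdual (qp *\<^sub>R evec 3)]"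
    (is "is_basis_list l_alg ?bs")
proof -
  note coord = in_V_def in_Vdual_def in_gl_def e_up_def tensor_def vec_eq_iff forall_3 sum_3
    axis_def trace_def trace_free_diag_def zero_prod_def
  have nz: "\<not> (a1 = 0 \<and> a2 = 0)" "\<not> (b1 = 0 \<and> b2 = 0)"
    using det by auto
  have "distinct ?bs"
    using nonzero nz det by (auto simp: coord)
  moreover have "independent (set ?bs)"
    using nonzero nz det by (auto simp: independent_insert span_breakdown_eq coord)
  moreover have "span (set ?bs) = l_alg"
  proof
    have "set ?bs \<subseteq> l_alg"
      by (auto simp: in_V_def in_Vdual_def in_gl_def l_alg_iff)
        (simp_all add: coord)
    then show "span (set ?bs) \<subseteq> l_alg"
      using l_alg_lie_algebra by (simp add: lie_algebra_on_def span_minimal)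
  next
    show "l_alg \<subseteq> span (set ?bs)"
    proof
      fix v
      assume "v \<in> l_alg"
      then obtain x A \<xi> where v: "v = (x, A, \<xi>)" "(x, A, \<xi>) \<in> l_alg"
        by (cases v) auto
      define D where "D = a1 * b2 - a2 * b1"
      have "D \<noteq> 0"
        using det by (simp add: D_def)
      \<comment> \<open>Cramer's rule for the first two diagonal entries of \<open>A\<close>; the
        third then agrees because all traces vanish.\<close>
      define c where "c = (A $ 1 $ 1 * b2 - A $ 2 $ 2 * b1) / D"
      define d where "d = (a1 * A $ 2 $ 2 - a2 * A $ 1 $ 1) / D"
      have "D * (c * a1 + d * b1) = D * A $ 1 $ 1" "D * (c * a2 + d * b2) = D * A $ 2 $ 2"
        using \<open>D \<noteq> 0\<close> by (simp_all add: c_def d_def distrib_left)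
          (simp_all add: D_def algebra_simps)
      then have cd: "A $ 1 $ 1 = c * a1 + d * b1" "A $ 2 $ 2 = c * a2 + d * b2"
        using \<open>D \<noteq> 0\<close> by simp_all
      have "v = (A $ 1 $ 3 / g0) *\<^sub>R in_gl (g0 *\<^sub>R e_up 1 3)
        + c *\<^sub>R in_gl (trace_free_diag a1 a2) + (\<xi> $ 2 / g1) *\<^sub>R in_Vdual (g1 *\<^sub>R evec 2)
        + d *\<^sub>R in_gl (trace_free_diag b1 b2) + (A $ 1 $ 2 / pm) *\<^sub>R in_gl (pm *\<^sub>R e_up 1 2)
        + (x $ 1 / pp) *\<^sub>R in_V (pp *\<^sub>R evec 1) + (A $ 2 $ 3 / qm) *\<^sub>R in_gl (qm *\<^sub>R e_up 2 3)
        + (\<xi> $ 3 / qp) *\<^sub>R in_Vdual (qp *\<^sub>R evec 3)"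
        using v(2) nonzero by (simp add: v(1) l_alg_iff coord cd algebra_simps)
      also have "\<dots> \<in> span (set ?bs)"
        by (intro span_add span_scale span_base) simp_all
      finally show "v \<in> span (set ?bs)" .
    qed
  qed
  ultimately show ?thesis
    by (simp add: is_basis_list_def)
qed

theorem proposition3:
  shows "\<exists>G0 H0 G1 H1 Pm Pp Qm Qp :: vec_end_covec.
    is_basis_list l_alg [G0, H0, G1, H1, Pm, Pp, Qm, Qp]
    \<and> g2_bracket H0 G0 = G0
    \<and> g2_bracket H1 G1 = (1 / sqrt 3) *\<^sub>R G1
    \<and> (\<forall>U \<in> span {Pm, Pp, Qm, Qp}. g2_bracket H0 U = (1 / 2) *\<^sub>R U)
    \<and> g2_bracket H1 Pm = (sqrt 3 / 2) *\<^sub>R Pm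
    \<and> g2_bracket H1 Pp = (1 / (2 * sqrt 3)) *\<^sub>R Pp
    \<and> g2_bracket H1 Qm = - (sqrt 3 / 2) *\<^sub>R Qm
    \<and> g2_bracket H1 Qp = - (1 / (2 * sqrt 3)) *\<^sub>R Qp
    \<and> g2_bracket G1 Pp = - Pm
    \<and> g2_bracket G1 Qm = Qp
    \<and> g2_bracket G1 Qp = (2 / sqrt 3) *\<^sub>R Pp
    \<and> g2_bracket Qm Pm = G0
    \<and> g2_bracket Qp Pp = G0
    \<and> g2_bracket G0 G1 = 0
    \<and> g2_bracket G0 H1 = 0
    \<and> (\<forall>U \<in> {Pm, Pp, Qm, Qp}. g2_bracket G0 U = 0)
    \<and> g2_bracket H0 G1 = 0
    \<and> g2_bracket H0 H1 = 0
    \<and> g2_bracket G1 Pm = 0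
    \<and> g2_bracket Pm Pp = 0
    \<and> g2_bracket Qm Qp = 0
    \<and> g2_bracket Qm Pp = 0
    \<and> g2_bracket Qp Pm = 0"
proof -
  \<comment> \<open>The bracket 2 e_1 of e^2 and e^3 must be 2 / \<open>sqrt 3\<close> times
    \<open>Pp\<close>; the factor 3 in the bracket of V with its dual enters \<open>Pm\<close>. The
    sign of \<open>G0\<close> comes from the product e_1^2 e_2^3 = e_1^3 in the commutator.\<close>
  define G0 where "G0 = in_gl ((- 3 * sqrt 3) *\<^sub>R e_up 1 3)"
  define G1 where "G1 = in_Vdual (evec 2)"
  define Pm where "Pm = in_gl ((3 * sqrt 3) *\<^sub>R e_up 1 2)"
  define Pp where "Pp = in_V (sqrt 3 *\<^sub>R evec 1)"
  define Qm where "Qm = in_gl (e_up 2 3)"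
  define Qp where "Qp = in_Vdual (evec 3)"
  \<comment> \<open>A matrix diag(h1, h2, h3) acts on e^2 by -h2 and on e_2^3 by h2 - h3. The
    eigenvalues required on \<open>G1\<close> and \<open>Qm\<close>, with trace zero, give the
    entries.\<close>
  define H0 where "H0 = in_gl (trace_free_diag (1 / 2) 0)"
  define H1 where "H1 = in_gl (trace_free_diag (1 / (2 * sqrt 3)) (- (1 / sqrt 3)))"
  note coord = in_V_def in_Vdual_def in_gl_def e_up_def tensor_def vec_eq_iff forall_3 sum_3
    axis_def trace_free_diag_def zero_prod_def matrix_vector_mult_def matrix_matrix_mult_def
    transpose_def mat_def dual_action_def cross3_def inner_vec_def
    G0_def G1_def H0_def H1_def Pm_def Pp_def Qm_def Qp_def
  \<comment> \<open>The last four instances are \<open>a1\<close>, \<open>b2\<close>,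
    \<open>a2\<close>, \<open>b1\<close>, in this order; the determinant is -1 / (2
    \<open>sqrt 3\<close>).\<close>
  have "is_basis_list l_alg [G0, H0, G1, H1, Pm, Pp, Qm, Qp]"
    using root_basis_l_alg[of "- 3 * sqrt 3" 1 "3 * sqrt 3" "sqrt 3" 1 1
        "1 / 2" "- (1 / sqrt 3)" 0 "1 / (2 * sqrt 3)"]
    by (simp add: G0_def G1_def H0_def H1_def Pm_def Pp_def Qm_def Qp_def)
  moreover have "g2_bracket H0 U = (1 / 2) *\<^sub>R U" if "U \<in> span {Pm, Pp, Qm, Qp}" for U
    using that by (cases U) (auto simp: span_breakdown_eq coord)
  moreover have "g2_bracket H0 G0 = G0"
    "g2_bracket H1 G1 = (1 / sqrt 3) *\<^sub>R G1"
    "g2_bracket H1 Pm = (sqrt 3 / 2) *\<^sub>R Pm"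
    "g2_bracket H1 Pp = (1 / (2 * sqrt 3)) *\<^sub>R Pp"
    "g2_bracket H1 Qm = - (sqrt 3 / 2) *\<^sub>R Qm"
    "g2_bracket H1 Qp = - (1 / (2 * sqrt 3)) *\<^sub>R Qp"
    "g2_bracket G1 Pp = - Pm"
    "g2_bracket G1 Qm = Qp"
    "g2_bracket G1 Qp = (2 / sqrt 3) *\<^sub>R Pp"
    "g2_bracket Qm Pm = G0"
    "g2_bracket Qp Pp = G0"
    "g2_bracket G0 G1 = 0"
    "g2_bracket G0 H1 = 0"
    "\<forall>U \<in> {Pm, Pp, Qm, Qp}. g2_bracket G0 U = 0"
    "g2_bracket H0 G1 = 0"
    "g2_bracket H0 H1 = 0"
    "g2_bracket G1 Pm = 0"
    "g2_bracket Pm Pp = 0"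
    "g2_bracket Qm Qp = 0"
    "g2_bracket Qm Pp = 0"
    "g2_bracket Qp Pm = 0"
    by (simp_all add: coord field_simps)
  ultimately show ?thesis
    by blast
qed

end
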